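(* For any cubic polynomial $p:\mathbb{R}^n\to\mathbb{R}$, the set of local minima of $p$ is a convex subset of $\mathbb{R}^n$.
   Context: A cubic polynomial is a real polynomial all of whose monomials have degree at most 3. A point $\bar x$ is a local minimum of $p$ if there is $\epsilon>0$ such that $p(\bar x)\le p(y)$ for all $y$ with $\|y-\bar x\|\le\epsilon$ (the inequality need not be strict). The set of local minima may be empty. *)

theory Defs
  imports "HOL-Analysis.Analysis"
begin

text \<open>Multi-indices are functions \<open>\<alpha> :: 'n \<Rightarrow> nat\<close> on the finite coordinate type; the monomial
  \<open>x\<^sup>\<alpha> = (\<Prod>i. x\<^sub>i ^ \<alpha>\<^sub>i)\<close> has total degree \<open>\<Sum>i. \<alpha>\<^sub>i\<close>.\<close>

definition monom_fun :: "('n::finite \<Rightarrow> nat) \<Rightarrow> real ^ 'n \<Rightarrow> real" where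
  "monom_fun \<alpha> x = (\<Prod>i\<in>UNIV. (x $ i) ^ \<alpha> i)"

definition multi_indices :: "nat \<Rightarrow> ('n::finite \<Rightarrow> nat) set" where
  "multi_indices d = {\<alpha>. (\<Sum>i\<in>UNIV. \<alpha> i) \<le> d}"

text \<open>The sum in \<open>cubic_polynomial\<close> below is over a finite set, so it is a genuine sum.\<close>

lemma finite_multi_indices: "finite (multi_indices d :: ('n::finite \<Rightarrow> nat) set)"
proof (rule finite_subset)
  show "multi_indices d \<subseteq> (PiE UNIV (\<lambda>_. {..d}) :: ('n \<Rightarrow> nat) set)"
  proof
    fix \<alpha> :: "'n \<Rightarrow> nat" assume "\<alpha> \<in> multi_indices d"
    then have *: "(\<Sum>i\<in>UNIV. \<alpha> i) \<le> d" by (simp add: multi_indices_def)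
    have "\<alpha> i \<le> d" for i
      using member_le_sum[of i UNIV \<alpha>] * by simp
    then show "\<alpha> \<in> PiE UNIV (\<lambda>_. {..d})" by auto
  qed
qed (simp add: finite_PiE)

text \<open>The degree is at most 3: polynomials of lower degree, constants included, also count.\<close>

definition cubic_polynomial :: "(real ^ 'n::finite \<Rightarrow> real) \<Rightarrow> bool" where
  "cubic_polynomial p \<longleftrightarrow>
     (\<exists>c :: ('n \<Rightarrow> nat) \<Rightarrow> real. \<forall>x. p x = (\<Sum>\<alpha>\<in>multi_indices 3. c \<alpha> * monom_fun \<alpha> x))"

definition local_min :: "(real ^ 'n::finite \<Rightarrow> real) \<Rightarrow> real ^ 'n \<Rightarrow> bool" where
  "local_min p x \<longleftrightarrow> (\<exists>\<epsilon>>0. \<forall>y. norm (y - x) \<le> \<epsilon> \<longrightarrow> p x \<le> p y)"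

end

theory Submission
  imports Defs "HOL-Computational_Algebra.Polynomial"
begin

text \<open>Let \<open>x\<close> and \<open>y\<close> be local minima and \<open>d = y - x\<close>. A univariate cubic with two distinct local
  minima is constant, so \<open>p\<close> is constant on the line through \<open>x\<close> and \<open>y\<close>, and the points of that
  line near \<open>x\<close> are local minima as well. Expand \<open>p (x + s d + u h)\<close> in powers of \<open>u\<close>: the
  coefficient of \<open>u\<close> has degree at most 2 in \<open>s\<close> and vanishes for all small \<open>s\<close>, hence identically,
  while the coefficients of \<open>u\<^sup>2\<close> and \<open>u\<^sup>3\<close> have degree at most 1 in \<open>s\<close>. Therefore
  \<open>p (x + s d + h) - p (x + s d)\<close> is affine in \<open>s\<close>. Being nonnegative for small \<open>h\<close> at \<open>s = 0\<close>
  and \<open>s = 1\<close>, it is nonnegative for all \<open>s\<close> in between.\<close>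

text \<open>An element \<open>A\<close> of \<open>real poly poly\<close> stands for a polynomial in an inner variable \<open>s\<close> and an
  outer variable \<open>u\<close>; its value is \<open>poly (poly A [:u:]) s\<close>.\<close>

definition total_degree_le :: "nat \<Rightarrow> 'a::zero poly poly \<Rightarrow> bool" where
  "total_degree_le k A \<longleftrightarrow> (\<forall>i j. k < i + j \<longrightarrow> coeff (coeff A j) i = 0)"

lemma total_degree_le_mono: "total_degree_le k A \<Longrightarrow> k \<le> l \<Longrightarrow> total_degree_le l A"
  by (auto simp: total_degree_le_def)

lemma total_degree_le_one: "total_degree_le 0 (1 :: 'a::comm_semiring_1 poly poly)"
  by (auto simp: total_degree_le_def one_pCons coeff_pCons split: nat.splits)

lemma total_degree_le_smult:
  "total_degree_le k A \<Longrightarrow> total_degree_le k (smult [:c:] A)" for c :: "'a::comm_semiring_1"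
  by (simp add: total_degree_le_def)

lemma total_degree_le_sum:
  "(\<And>i. i \<in> I \<Longrightarrow> total_degree_le k (A i)) \<Longrightarrow> total_degree_le k (\<Sum>i\<in>I. A i)"
  for A :: "'b \<Rightarrow> 'a::comm_monoid_add poly poly"
  by (simp add: total_degree_le_def coeff_sum)

text \<open>A product contributing to the coefficient at \<open>(i, j)\<close> has exponent pairs
  adding up to \<open>(i, j)\<close>, so one factor exceeds its own degree bound and has coefficient
  zero.\<close>

lemma total_degree_le_mult:
  fixes A B :: "'a::comm_semiring_0 poly poly"
  assumes "total_degree_le k A" "total_degree_le l B"
  shows "total_degree_le (k + l) (A * B)"
  unfolding total_degree_le_def
proof (intro allI impI)
  fix i j assume ij: "k + l < i + j"
  have "coeff (coeff A m) n * coeff (coeff B (j - m)) (i - n) = 0" if "m \<le> j" "n \<le> i" for m n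
  proof (cases "k < n + m")
    case True
    then show ?thesis using assms(1) by (simp add: total_degree_le_def)
  next
    case False
    then have "l < (i - n) + (j - m)" using ij that by linarith
    then show ?thesis using assms(2) by (simp add: total_degree_le_def)
  qed
  then show "coeff (coeff (A * B) j) i = 0"
    by (simp add: coeff_mult coeff_sum)
qed

lemma total_degree_le_power:
  "total_degree_le k A \<Longrightarrow> total_degree_le (n * k) (A ^ n)"
  for A :: "'a::comm_semiring_1 poly poly"
  by (induction n) (auto simp: total_degree_le_one total_degree_le_mult)

lemma total_degree_le_prod:
  "finite I \<Longrightarrow> (\<And>i. i \<in> I \<Longrightarrow> total_degree_le (k i) (A i)) \<Longrightarrow>
    total_degree_le (\<Sum>i\<in>I. k i) (\<Prod>i\<in>I. A i)"
  for A :: "'b \<Rightarrow> 'a::comm_semiring_1 poly poly"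
  by (induction I rule: finite_induct) (auto simp: total_degree_le_one total_degree_le_mult)

text \<open>Every coordinate of the point is an affine form in \<open>s\<close> and
  \<open>u\<close>, so substitution turns a monomial into a bivariate polynomial of no larger total
  degree.\<close>

lemma cubic_polynomial_on_plane:
  fixes p :: "real ^ 'n::finite \<Rightarrow> real"
  assumes "cubic_polynomial p"
  obtains A where "total_degree_le 3 A"
    and "\<And>s u. p (x + s *\<^sub>R d + u *\<^sub>R h) = poly (poly A [:u:]) s"
proof -
  obtain c where c: "\<And>x. p x = (\<Sum>\<alpha>\<in>multi_indices 3. c \<alpha> * monom_fun \<alpha> x)"
    using assms unfolding cubic_polynomial_def by blast
  \<comment> \<open>Coordinate \<open>i\<close> as a bivariate polynomial:
    \<open>x $ i + s * d $ i\<close> is constant in \<open>u\<close>, and \<open>h $ i\<close> is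
    the coefficient of \<open>u\<close>.\<close>
  define L where "L i = [: [:x $ i, d $ i:], [:h $ i:] :]" for i
  define M where "M \<alpha> = smult [:c \<alpha>:] (\<Prod>i\<in>UNIV. L i ^ \<alpha> i)" for \<alpha>
  have L: "total_degree_le 1 (L i)" for i
    by (auto simp: total_degree_le_def L_def coeff_pCons split: nat.splits)
  have "total_degree_le (\<Sum>i\<in>UNIV. \<alpha> i * 1) (M \<alpha>)" for \<alpha>
    unfolding M_def by (intro total_degree_le_smult total_degree_le_prod total_degree_le_power L) simp
  then have "total_degree_le 3 (M \<alpha>)" if "\<alpha> \<in> multi_indices 3" for \<alpha>
    by (rule total_degree_le_mono) (use that in \<open>simp add: multi_indices_def\<close>)
  then have "total_degree_le 3 (\<Sum>\<alpha>\<in>multi_indices 3. M \<alpha>)"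
    by (rule total_degree_le_sum)
  moreover have "p (x + s *\<^sub>R d + u *\<^sub>R h) = poly (poly (\<Sum>\<alpha>\<in>multi_indices 3. M \<alpha>) [:u:]) s" for s u
    by (simp add: c poly_sum M_def L_def poly_prod monom_fun_def algebra_simps)
  ultimately show thesis by (rule that)
qed

text \<open>Total degree at most 3 leaves the coefficient of \<open>u ^ j\<close> degree at most
  \<open>3 - j\<close> in \<open>s\<close>: linear for \<open>j = 2\<close>, constant for
  \<open>j = 3\<close>.\<close>

lemma cubic_polynomial_expansion:
  fixes p :: "real ^ 'n::finite \<Rightarrow> real"
  assumes "cubic_polynomial p"
  obtains a b :: "real poly" and c\<^sub>0 c\<^sub>1 e where "degree a \<le> 3"
    and "\<And>s u. p (x + s *\<^sub>R d + u *\<^sub>R h) = poly a s + u * poly b s + u\<^sup>2 * (c\<^sub>0 + c\<^sub>1 * s) + u ^ 3 * e"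
proof -
  obtain A where A: "total_degree_le 3 A"
    and p: "\<And>s u. p (x + s *\<^sub>R d + u *\<^sub>R h) = poly (poly A [:u:]) s"
    using cubic_polynomial_on_plane[OF assms] by blast
  have A0: "coeff (coeff A j) i = 0" if "3 < i + j" for i j
    using A that by (simp add: total_degree_le_def)
  have degA: "degree A \<le> 3"
    by (rule degree_le) (auto intro: poly_eqI simp: A0)
  have deg: "degree (coeff A j) \<le> 3 - j" if "j \<le> 3" for j
    using that by (intro degree_le) (auto simp: A0)
  obtain c\<^sub>0 c\<^sub>1 where c: "coeff A 2 = [:c\<^sub>0, c\<^sub>1:]"
  proof
    show "coeff A 2 = [:coeff (coeff A 2) 0, coeff (coeff A 2) 1:]"
      by (auto simp: poly_eq_iff coeff_pCons A0 split: nat.splits)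
  qed
  obtain e where e: "coeff A 3 = [:e:]"
    using deg[of 3] degree_0_id[of "coeff A 3"] by (metis degree_eq_zeroE diff_self_eq_0 le_0_eq order_refl)
  have "A = [:coeff A 0, coeff A 1, coeff A 2, coeff A 3:]"
    using degA by (auto simp: poly_eq_iff coeff_pCons coeff_eq_0 numeral_eq_Suc split: nat.splits)
  then have "poly A [:u:] = coeff A 0 + [:u:] * (coeff A 1 + [:u:] * ([:c\<^sub>0, c\<^sub>1:] + [:u:] * [:e:]))" for u
    by (metis (no_types) c e poly_pCons poly_0 mult_zero_right add_0_right)
  then have "p (x + s *\<^sub>R d + u *\<^sub>R h) = poly (coeff A 0) s + u * poly (coeff A 1) s
      + u\<^sup>2 * (c\<^sub>0 + c\<^sub>1 * s) + u ^ 3 * e" for s u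
    unfolding p by (simp add: algebra_simps power2_eq_square power3_eq_cube)
  with deg[of 0] show thesis by (intro that) auto
qed

lemma local_min_along_line:
  assumes "local_min p x"
  obtains \<delta> where "\<delta> > 0" "\<And>s. \<bar>s\<bar> < \<delta> \<Longrightarrow> p x \<le> p (x + s *\<^sub>R d)"
proof -
  obtain \<epsilon> where \<epsilon>: "\<epsilon> > 0" "\<And>y. norm (y - x) \<le> \<epsilon> \<Longrightarrow> p x \<le> p y"
    using assms unfolding local_min_def by blast
  show thesis
  proof
    \<comment> \<open>The summand 1 keeps the radius positive when \<open>d = 0\<close>.\<close>
    show "\<epsilon> / (norm d + 1) > 0" using \<epsilon>(1) by (simp add: add_nonneg_pos)
    fix s assume "\<bar>s\<bar> < \<epsilon> / (norm d + 1)"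
    then have "\<bar>s\<bar> * (norm d + 1) < \<epsilon>" by (simp add: pos_less_divide_eq add_nonneg_pos)
    then have "norm (x + s *\<^sub>R d - x) \<le> \<epsilon>" by (simp add: algebra_simps)
    then show "p x \<le> p (x + s *\<^sub>R d)" by (rule \<epsilon>(2))
  qed
qed

lemma local_min_imp_deriv_zero:
  assumes "local_min p x" "((\<lambda>u. p (x + u *\<^sub>R h)) has_real_derivative D) (at 0)"
  shows "D = 0"
proof -
  obtain \<delta> where "\<delta> > 0" "\<And>s. \<bar>s\<bar> < \<delta> \<Longrightarrow> p x \<le> p (x + s *\<^sub>R h)"
    using local_min_along_line[OF assms(1)] by blast
  then show ?thesis
    by (intro DERIV_local_min[OF assms(2), of \<delta>]) auto
qed

text \<open>A ball of half the radius around \<open>z\<close> stays inside the ball around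
  \<open>x\<close>, and equal values carry the lower bound from \<open>x\<close> to
  \<open>z\<close>.\<close>

lemma local_min_nearby:
  assumes "local_min p x"
  obtains \<delta> where "\<delta> > 0" "\<And>z. norm (z - x) \<le> \<delta> \<Longrightarrow> p z = p x \<Longrightarrow> local_min p z"
proof -
  obtain \<epsilon> where \<epsilon>: "\<epsilon> > 0" "\<And>y. norm (y - x) \<le> \<epsilon> \<Longrightarrow> p x \<le> p y"
    using assms unfolding local_min_def by blast
  show thesis
  proof
    show "\<epsilon> / 2 > 0" using \<epsilon>(1) by simp
    fix z assume z: "norm (z - x) \<le> \<epsilon> / 2" "p z = p x"
    have "p z \<le> p y" if "norm (y - z) \<le> \<epsilon> / 2" for y
      using norm_triangle_ineq[of "y - z" "z - x"] that z by (auto intro!: \<epsilon>(2))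
    then show "local_min p z" using \<epsilon>(1) unfolding local_min_def by (intro exI[of _ "\<epsilon> / 2"]) auto
  qed
qed

text \<open>Critical points at 0 and 1 force the derivative to be
  \<open>2 * a2 * s * (1 - s)\<close>. A minimum at 0 requires \<open>a2 \<ge> 0\<close>, a minimum
  at 1 requires \<open>a2 \<le> 0\<close>.\<close>

lemma cubic_two_local_mins_constant:
  fixes a :: "real poly"
  assumes deg: "degree a \<le> 3"
    and min0: "\<delta> > 0" "\<And>s. \<bar>s\<bar> < \<delta> \<Longrightarrow> poly a 0 \<le> poly a s"
    and min1: "\<epsilon> > 0" "\<And>s. \<bar>s\<bar> < \<epsilon> \<Longrightarrow> poly a 1 \<le> poly a (1 + s)"
  shows "poly a s = poly a 0"
proof -
  define a1 a2 a3 where a_defs: "a1 = coeff a 1" "a2 = coeff a 2" "a3 = coeff a 3"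
  have a: "a = [:coeff a 0, a1, a2, a3:]"
    using deg by (auto simp: a_defs poly_eq_iff coeff_pCons coeff_eq_0 numeral_eq_Suc split: nat.splits)
  have pderiv_a: "pderiv a = [:a1, 2 * a2, 3 * a3:]"
    by (subst a) (simp add: pderiv_pCons)
  have "poly (pderiv a) 0 = 0"
    using min0 by (intro DERIV_local_min[OF poly_DERIV, of \<delta>]) auto
  moreover have "poly (pderiv a) 1 = 0"
  proof (rule DERIV_local_min[OF poly_DERIV min1(1)], intro allI impI)
    fix s assume "\<bar>1 - s\<bar> < \<epsilon>"
    then show "poly a 1 \<le> poly a s" using min1(2)[of "s - 1"] by simp
  qed
  ultimately have a1: "a1 = 0" and a3: "3 * a3 = - 2 * a2"
    by (simp_all add: pderiv_a)
  have eval: "poly a s = poly a 0 + a2 * (s\<^sup>2 - 2 / 3 * s ^ 3)" for s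
  proof -
    have a3': "a3 = - 2 / 3 * a2" using a3 by simp
    show ?thesis
      by (subst (1 2) a) (simp add: a1 a3' algebra_simps power2_eq_square power3_eq_cube)
  qed
  have "a2 \<ge> 0"
  proof -
    \<comment> \<open>A step within reach of the minimum at 0, small enough for
      \<open>1 - 2 / 3 * r\<close> to be positive.\<close>
    define r where "r = min \<delta> 1 / 2"
    have r: "0 < r" "r < \<delta>" "r \<le> 1 / 2" using min0(1) by (auto simp: r_def)
    have "0 \<le> a2 * (r\<^sup>2 * (1 - 2 / 3 * r))"
      using min0(2)[of r] r eval[of r] by (simp add: algebra_simps power2_eq_square power3_eq_cube)
    moreover have "0 < r\<^sup>2 * (1 - 2 / 3 * r)" using r by simp
    ultimately show ?thesis by (simp add: zero_le_mult_iff)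
  qed
  moreover have "a2 \<le> 0"
  proof -
    define r where "r = min \<epsilon> 1 / 2"
    have r: "0 < r" "r < \<epsilon>" "r \<le> 1 / 2" using min1(1) by (auto simp: r_def)
    \<comment> \<open>The terms linear in \<open>r\<close> cancel because 1 is a critical
      point.\<close>
    have "poly a (1 + r) - poly a 1 = - a2 * (r\<^sup>2 * (1 + 2 / 3 * r))"
      unfolding eval[of "1 + r"] eval[of 1] by (simp add: field_simps power2_eq_square power3_eq_cube)
    then have "0 \<le> - a2 * (r\<^sup>2 * (1 + 2 / 3 * r))"
      using min1(2)[of r] r by simp
    moreover have "0 < r\<^sup>2 * (1 + 2 / 3 * r)" using r by simp
    ultimately show ?thesis by (metis mult_minus_left neg_0_le_iff_le not_less mult_pos_pos)
  qed
  ultimately show ?thesis using eval[of s] by simp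
qed

lemma cubic_constant_on_line_through_local_mins:
  fixes p :: "real ^ 'n::finite \<Rightarrow> real"
  assumes "cubic_polynomial p" "local_min p x" "local_min p (x + d)"
  shows "p (x + s *\<^sub>R d) = p x"
proof -
  \<comment> \<open>With \<open>h = 0\<close> the plane collapses to the line, and
    \<open>u = 0\<close> then leaves only the univariate cubic \<open>a\<close>, whose local minima
    at 0 and 1 come from \<open>x\<close> and \<open>x + d\<close>.\<close>
  obtain a b c\<^sub>0 c\<^sub>1 e where deg: "degree a \<le> 3" and p: "\<And>s u. p (x + s *\<^sub>R d + u *\<^sub>R 0) =
      poly a s + u * poly b s + u\<^sup>2 * (c\<^sub>0 + c\<^sub>1 * s) + u ^ 3 * e"
    using cubic_polynomial_expansion[OF assms(1)] by blast
  have a: "p (x + s *\<^sub>R d) = poly a s" for s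
    using p[of s 0] by simp
  obtain \<delta> where \<delta>: "\<delta> > 0" "\<And>s. \<bar>s\<bar> < \<delta> \<Longrightarrow> p x \<le> p (x + s *\<^sub>R d)"
    using local_min_along_line[OF assms(2)] by blast
  obtain \<epsilon> where \<epsilon>: "\<epsilon> > 0" "\<And>s. \<bar>s\<bar> < \<epsilon> \<Longrightarrow> p (x + d) \<le> p (x + d + s *\<^sub>R d)"
    using local_min_along_line[OF assms(3)] by blast
  have "poly a s = poly a 0"
  proof (rule cubic_two_local_mins_constant[OF deg \<delta>(1) _ \<epsilon>(1)])
    show "poly a 0 \<le> poly a s" if "\<bar>s\<bar> < \<delta>" for s
      using \<delta>(2)[OF that] a[of 0] a[of s] by simp
    show "poly a 1 \<le> poly a (1 + s)" if "\<bar>s\<bar> < \<epsilon>" for s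
      using \<epsilon>(2)[OF that] a[of 1] a[of "1 + s"] by (simp add: algebra_simps)
  qed
  then show ?thesis using a[of s] a[of 0] by simp
qed

lemma cubic_increment_affine:
  fixes p :: "real ^ 'n::finite \<Rightarrow> real"
  assumes cubic: "cubic_polynomial p" and mins: "local_min p x" "local_min p (x + d)"
  shows "p (x + t *\<^sub>R d + h) - p (x + t *\<^sub>R d) =
    (1 - t) * (p (x + h) - p x) + t * (p (x + d + h) - p (x + d))"
proof -
  obtain a b c\<^sub>0 c\<^sub>1 e where "degree a \<le> 3" and p: "\<And>s u. p (x + s *\<^sub>R d + u *\<^sub>R h) =
      poly a s + u * poly b s + u\<^sup>2 * (c\<^sub>0 + c\<^sub>1 * s) + u ^ 3 * e"
    using cubic_polynomial_expansion[OF cubic] by blast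
  obtain \<delta> where \<delta>: "\<delta> > 0" "\<And>z. norm (z - x) \<le> \<delta> \<Longrightarrow> p z = p x \<Longrightarrow> local_min p z"
    using local_min_nearby[OF mins(1)] by blast
  define \<eta> where "\<eta> = \<delta> / (norm d + 1)"
  have \<eta>: "\<eta> > 0" using \<delta>(1) by (simp add: \<eta>_def add_nonneg_pos)
  \<comment> \<open>\<open>poly b s\<close> is the derivative of \<open>p\<close> in direction
    \<open>h\<close> at \<open>x + s *\<^sub>R d\<close>, which is itself a local minimum for small
    \<open>s\<close>.\<close>
  have "poly b s = 0" if s: "s \<in> {0<..<\<eta>}" for s
  proof (rule local_min_imp_deriv_zero)
    have "s * (norm d + 1) < \<delta>" using s by (simp add: \<eta>_def pos_less_divide_eq add_nonneg_pos)
    then have "norm (x + s *\<^sub>R d - x) \<le> \<delta>" using s by (simp add: algebra_simps)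
    then show "local_min p (x + s *\<^sub>R d)"
      using cubic_constant_on_line_through_local_mins[OF cubic mins] by (rule \<delta>(2))
    show "((\<lambda>u. p (x + s *\<^sub>R d + u *\<^sub>R h)) has_real_derivative poly b s) (at 0)"
      unfolding p by (auto intro!: derivative_eq_intros)
  qed
  then have "{0<..<\<eta>} \<subseteq> {s. poly b s = 0}" by blast
  then have "infinite {s. poly b s = 0}"
    using infinite_Ioo[OF \<eta>] finite_subset by blast
  then have "b = 0" using poly_roots_finite by blast
  \<comment> \<open>Subtracting the expansion at \<open>u = 0\<close> from that at
    \<open>u = 1\<close> cancels \<open>a\<close>. The result is affine in \<open>s\<close>, hence
    interpolates its values at 0 and 1.\<close>
  then have "p (x + s *\<^sub>R d + h) - p (x + s *\<^sub>R d) = c\<^sub>0 + c\<^sub>1 * s + e" for s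
    using p[of s 1] p[of s 0] by simp
  from this[of t] this[of 0] this[of 1] show ?thesis by (simp add: algebra_simps)
qed

theorem theorem4p3:
  fixes p :: "real ^ 'n::finite \<Rightarrow> real"
  assumes "cubic_polynomial p"
  shows "convex {x. local_min p x}"
  unfolding convex_alt
proof (intro ballI allI impI)
  fix x y :: "real ^ 'n" and t :: real
  assume xy: "x \<in> {x. local_min p x}" "y \<in> {x. local_min p x}" and t: "0 \<le> t \<and> t \<le> 1"
  define z where "z = (1 - t) *\<^sub>R x + t *\<^sub>R y"
  have z: "z = x + t *\<^sub>R (y - x)" by (simp add: z_def algebra_simps)
  obtain \<delta> where \<delta>: "\<delta> > 0" "\<And>v. norm (v - x) \<le> \<delta> \<Longrightarrow> p x \<le> p v"
    using xy unfolding local_min_def by blast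
  obtain \<epsilon> where \<epsilon>: "\<epsilon> > 0" "\<And>v. norm (v - y) \<le> \<epsilon> \<Longrightarrow> p y \<le> p v"
    using xy unfolding local_min_def by blast
  \<comment> \<open>The same displacement \<open>h\<close> is applied at \<open>x\<close>,
    \<open>y\<close> and \<open>z\<close>, so the smaller radius serves all three points.\<close>
  have "p z \<le> p v" if "norm (v - z) \<le> min \<delta> \<epsilon>" for v
  proof -
    define h where "h = v - z"
    have "p (z + h) - p z = (1 - t) * (p (x + h) - p x) + t * (p (y + h) - p y)"
      using cubic_increment_affine[OF assms, of x "y - x" t h] xy by (simp add: z)
    moreover have "p x \<le> p (x + h)" "p y \<le> p (y + h)"
      using that by (auto simp: h_def intro!: \<delta>(2) \<epsilon>(2))
    ultimately have "0 \<le> p (z + h) - p z" using t by simp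
    then show ?thesis by (simp add: h_def)
  qed
  then have "local_min p z"
    unfolding local_min_def using \<delta>(1) \<epsilon>(1) by (intro exI[of _ "min \<delta> \<epsilon>"]) auto
  then show "(1 - t) *\<^sub>R x + t *\<^sub>R y \<in> {x. local_min p x}" by (simp add: z_def)
qed

end
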